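(* Let $G_1,G_2$ be finite simple connected graphs, $G_i$ having $n_i$ vertices and $m_i$ edges. Then the disjunction $G_1\wedge G_2$ satisfies \begin{align*} F(G_1\wedge G_2)={}&n_2^4F(G_1)+n_1^4F(G_2)-F(G_1)F(G_2)+6n_1n_2^2m_2M_1(G_1)+6n_1^2n_2m_1M_1(G_2)\\ &+3n_2F(G_1)M_1(G_2)+3n_1F(G_2)M_1(G_1)-6n_2^2m_2F(G_1)-6n_1^2m_1F(G_2)\\ &-6n_1n_2M_1(G_1)M_1(G_2). \end{align*}
   Context: The disjunction $G_1\wedge G_2$ has vertex set $V(G_1)\times V(G_2)$, with $(u_1,v_1)$ adjacent to $(u_2,v_2)$ iff $u_1u_2\in E(G_1)$ or $v_1v_2\in E(G_2)$. For a finite simple graph $G$ with vertex degrees $d_G(v)$: $M_1(G)=\sum_{v} d_G(v)^2$ and $F(G)=\sum_{v} d_G(v)^3$. *)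

theory Defs
  imports "Graph_Theory.Digraph_Component"
begin

text \<open>
  A finite simple graph is a \<^locale>\<open>pair_graph\<close>: finite, loop-free, without parallel
  arcs, and symmetric. Every undirected edge \<open>uv\<close> is thus represented by the two arcs
  \<open>(u, v)\<close> and \<open>(v, u)\<close>.
\<close>

definition uedges :: "'a pair_pre_digraph \<Rightarrow> 'a set set" where
  "uedges G = {{u, v} |u v. (u, v) \<in> parcs G}"

text \<open>
  By symmetry, the out-degree of \<open>v\<close> is the number of neighbours of \<open>v\<close>, i.e. its degree.
\<close>

definition degree :: "'a pair_pre_digraph \<Rightarrow> 'a \<Rightarrow> nat" where
  "degree G v = out_degree (with_proj G) v"

definition first_zagreb :: "'a pair_pre_digraph \<Rightarrow> nat" where
  "first_zagreb G = (\<Sum>v\<in>pverts G. degree G v ^ 2)"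

definition forgotten_index :: "'a pair_pre_digraph \<Rightarrow> nat" where
  "forgotten_index G = (\<Sum>v\<in>pverts G. degree G v ^ 3)"

definition disjunction ::
  "'a pair_pre_digraph \<Rightarrow> 'b pair_pre_digraph \<Rightarrow> ('a \<times> 'b) pair_pre_digraph" where
  "disjunction G H = \<lparr> pverts = pverts G \<times> pverts H,
     parcs = {((u1, v1), (u2, v2)) |u1 v1 u2 v2.
       (u1, v1) \<in> pverts G \<times> pverts H \<and> (u2, v2) \<in> pverts G \<times> pverts H \<and>
       ((u1, u2) \<in> parcs G \<or> (v1, v2) \<in> parcs H)} \<rparr>"

lemma (in pair_graph) degree_eq_card_neighbours:
  "degree G v = card {w. (v, w) \<in> parcs G}"
proof -
  have "out_arcs (with_proj G) v = Pair v ` {w. (v, w) \<in> parcs G}"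
    by (auto simp: out_arcs_def)
  then show ?thesis
    by (simp add: degree_def out_degree_def card_image inj_on_def)
qed

lemma pair_graph_disjunction:
  assumes "pair_graph G" "pair_graph H"
  shows "pair_graph (disjunction G H)"
proof -
  interpret G: pair_graph G by fact
  interpret H: pair_graph H by fact
  let ?D = "disjunction G H"
  have fin: "finite (pverts ?D)"
    by (simp add: disjunction_def G.pair_finite_verts H.pair_finite_verts)
  have sub: "parcs ?D \<subseteq> pverts ?D \<times> pverts ?D"
    by (auto simp: disjunction_def)
  have "finite (parcs ?D)"
    using finite_subset[OF sub] fin by simp
  moreover have "symmetric (with_proj ?D)"
    unfolding symmetric_def
    by (rule symI) (auto simp: disjunction_def dest: G.arcs_symmetric H.arcs_symmetric)
  moreover have "fst e \<noteq> snd e" if "e \<in> parcs ?D" for e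
    using that by (auto simp: disjunction_def dest: G.no_loops' H.no_loops')
  ultimately show ?thesis
    using fin sub by unfold_locales auto
qed

end

theory Submission
  imports Defs
begin

text \<open>
  By inclusion-exclusion a vertex \<open>(u, v)\<close> of the disjunction has degree
  \<open>n\<^sub>2 d(u) + n\<^sub>1 d(v) - d(u) d(v)\<close>. Expanding the cube and summing over all
  \<open>(u, v)\<close>, every monomial factors into a power sum of the degrees of each factor;
  those of exponent 1 are \<open>2 m\<^sub>1\<close> and \<open>2 m\<^sub>2\<close> by the handshake lemma.
\<close>

context pair_graph
begin

lemma card_parcs_eq_twice_card_uedges: "card (parcs G) = 2 * card (uedges G)"
proof -
  let ?f = "\<lambda>(u, v). {u, v}"
  have img: "?f ` parcs G = uedges G"
    by (force simp: uedges_def)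
  have fibre: "card {a \<in> parcs G. ?f a = e} = 2" if edge: "e \<in> uedges G" for e
  proof -
    obtain u v where e: "e = {u, v}" and uv: "(u, v) \<in> parcs G"
      using edge by (auto simp: uedges_def)
    have "(v, u) \<in> parcs G" and "u \<noteq> v"
      using uv arcs_symmetric no_loops' by auto
    then have "{a \<in> parcs G. ?f a = e} = {(u, v), (v, u)}"
      using uv by (auto simp: e doubleton_eq_iff)
    then show ?thesis
      using \<open>u \<noteq> v\<close> by simp
  qed
  have "card (parcs G) = (\<Sum>e\<in>?f ` parcs G. \<Sum>a\<in>{a \<in> parcs G. ?f a = e}. 1)"
    using sum.image_gen[of "parcs G" "\<lambda>_. 1 :: nat" ?f] pair_finite_arcs by simp
  also have "\<dots> = 2 * card (uedges G)"
    unfolding img using fibre by simp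
  finally show ?thesis .
qed

lemma finite_neighbours: "finite {w. (v, w) \<in> parcs G}"
  by (rule finite_subset[OF _ pair_finite_verts]) (auto dest: in_arcsD2)

lemma sum_degree_eq_twice_card_uedges: "(\<Sum>v\<in>pverts G. degree G v) = 2 * card (uedges G)"
proof -
  have "parcs G = (SIGMA v:pverts G. {w. (v, w) \<in> parcs G})"
    by (auto dest: in_arcsD1)
  then have "card (parcs G) = (\<Sum>v\<in>pverts G. card {w. (v, w) \<in> parcs G})"
    using card_SigmaI[OF pair_finite_verts, of "\<lambda>v. {w. (v, w) \<in> parcs G}"] finite_neighbours
    by simp
  then show ?thesis
    by (simp add: degree_eq_card_neighbours card_parcs_eq_twice_card_uedges)
qed

end

lemma degree_disjunction:
  assumes "pair_graph G" "pair_graph H" and u: "u \<in> pverts G" and v: "v \<in> pverts H"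
  shows "int (degree (disjunction G H) (u, v)) =
    int (card (pverts H)) * int (degree G u) + int (card (pverts G)) * int (degree H v)
    - int (degree G u) * int (degree H v)"
proof -
  interpret G: pair_graph G by fact
  interpret H: pair_graph H by fact
  interpret D: pair_graph "disjunction G H"
    by (rule pair_graph_disjunction) fact+
  let ?A = "{w. (u, w) \<in> parcs G}" and ?B = "{w. (v, w) \<in> parcs H}"
  let ?X = "?A \<times> pverts H" and ?Y = "pverts G \<times> ?B"
  have sub: "?A \<subseteq> pverts G" "?B \<subseteq> pverts H"
    by (auto dest: G.in_arcsD2 H.in_arcsD2)
  have "{w. ((u, v), w) \<in> parcs (disjunction G H)} = ?X \<union> ?Y"
    using u v sub by (auto simp: disjunction_def)
  moreover have "card ?X + card ?Y = card (?X \<union> ?Y) + card (?X \<inter> ?Y)"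
    by (rule card_Un_Int)
      (simp_all add: G.finite_neighbours H.finite_neighbours G.pair_finite_verts H.pair_finite_verts)
  moreover have "?X \<inter> ?Y = ?A \<times> ?B"
    using sub by auto
  ultimately have "degree G u * card (pverts H) + card (pverts G) * degree H v
      = degree (disjunction G H) (u, v) + degree G u * degree H v"
    by (simp add: G.degree_eq_card_neighbours H.degree_eq_card_neighbours
        D.degree_eq_card_neighbours card_cartesian_product)
  then have "int (degree G u * card (pverts H) + card (pverts G) * degree H v)
      = int (degree (disjunction G H) (u, v) + degree G u * degree H v)"
    by (rule arg_cong)
  then show ?thesis
    by (simp add: algebra_simps)
qed

lemma sum_cube_inclusion_exclusion:
  fixes f :: "'a \<Rightarrow> 'c :: comm_ring_1" and g :: "'b \<Rightarrow> 'c" and p q :: 'c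
  shows "(\<Sum>x\<in>A. \<Sum>y\<in>B. (q * f x + p * g y - f x * g y) ^ 3) =
      q ^ 3 * of_nat (card B) * (\<Sum>x\<in>A. f x ^ 3) + p ^ 3 * of_nat (card A) * (\<Sum>y\<in>B. g y ^ 3)
    - (\<Sum>x\<in>A. f x ^ 3) * (\<Sum>y\<in>B. g y ^ 3)
    + 3 * q ^ 2 * p * (\<Sum>x\<in>A. f x ^ 2) * (\<Sum>y\<in>B. g y)
    + 3 * q * p ^ 2 * (\<Sum>x\<in>A. f x) * (\<Sum>y\<in>B. g y ^ 2)
    + 3 * q * (\<Sum>x\<in>A. f x ^ 3) * (\<Sum>y\<in>B. g y ^ 2)
    + 3 * p * (\<Sum>x\<in>A. f x ^ 2) * (\<Sum>y\<in>B. g y ^ 3)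
    - 3 * q ^ 2 * (\<Sum>x\<in>A. f x ^ 3) * (\<Sum>y\<in>B. g y)
    - 3 * p ^ 2 * (\<Sum>x\<in>A. f x) * (\<Sum>y\<in>B. g y ^ 3)
    - 6 * q * p * (\<Sum>x\<in>A. f x ^ 2) * (\<Sum>y\<in>B. g y ^ 2)"
proof -
  have "(q * a + p * b - a * b) ^ 3 =
      q ^ 3 * a ^ 3 + p ^ 3 * b ^ 3 - a ^ 3 * b ^ 3
    + 3 * q ^ 2 * p * a ^ 2 * b + 3 * q * p ^ 2 * a * b ^ 2
    + 3 * q * a ^ 3 * b ^ 2 + 3 * p * a ^ 2 * b ^ 3
    - 3 * q ^ 2 * a ^ 3 * b - 3 * p ^ 2 * a * b ^ 3
    - 6 * q * p * a ^ 2 * b ^ 2" for a b :: 'c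
    by (simp add: power3_eq_cube power2_eq_square algebra_simps)
  then show ?thesis
    by (simp add: sum.distrib sum_subtractf flip: sum_distrib_left sum_distrib_right)
qed

theorem theorem10:
  fixes G1 :: "'a pair_pre_digraph" and G2 :: "'b pair_pre_digraph"
    and n1 n2 m1 m2 :: nat
  assumes "pair_graph G1" and "Digraph_Component.connected (with_proj G1)"
    and "pair_graph G2" and "Digraph_Component.connected (with_proj G2)"
    and "card (pverts G1) = n1" and "card (uedges G1) = m1"
    and "card (pverts G2) = n2" and "card (uedges G2) = m2"
  shows "int (forgotten_index (disjunction G1 G2)) =
      int n2 ^ 4 * int (forgotten_index G1) + int n1 ^ 4 * int (forgotten_index G2)
    - int (forgotten_index G1) * int (forgotten_index G2)
    + 6 * int n1 * int n2 ^ 2 * int m2 * int (first_zagreb G1)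
    + 6 * int n1 ^ 2 * int n2 * int m1 * int (first_zagreb G2)
    + 3 * int n2 * int (forgotten_index G1) * int (first_zagreb G2)
    + 3 * int n1 * int (forgotten_index G2) * int (first_zagreb G1)
    - 6 * int n2 ^ 2 * int m2 * int (forgotten_index G1)
    - 6 * int n1 ^ 2 * int m1 * int (forgotten_index G2)
    - 6 * int n1 * int n2 * int (first_zagreb G1) * int (first_zagreb G2)"
proof -
  interpret G1: pair_graph G1 by fact
  interpret G2: pair_graph G2 by fact
  have deg: "(\<Sum>v\<in>pverts G1. int (degree G1 v)) = 2 * int m1"
    "(\<Sum>v\<in>pverts G2. int (degree G2 v)) = 2 * int m2"
    using G1.sum_degree_eq_twice_card_uedges G2.sum_degree_eq_twice_card_uedges assms(6,8)
    by (simp_all flip: of_nat_sum)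
  have "int (forgotten_index (disjunction G1 G2)) =
      (\<Sum>(u, v)\<in>pverts G1 \<times> pverts G2. int (degree (disjunction G1 G2) (u, v)) ^ 3)"
    by (simp add: forgotten_index_def disjunction_def split_def)
  also have "\<dots> = (\<Sum>u\<in>pverts G1. \<Sum>v\<in>pverts G2. int (degree (disjunction G1 G2) (u, v)) ^ 3)"
    by (rule sum.cartesian_product[symmetric])
  also have "\<dots> = (\<Sum>u\<in>pverts G1. \<Sum>v\<in>pverts G2.
      (int n2 * int (degree G1 u) + int n1 * int (degree G2 v)
        - int (degree G1 u) * int (degree G2 v)) ^ 3)"
    using assms by (simp add: degree_disjunction)
  finally show ?thesis
    unfolding sum_cube_inclusion_exclusion deg assms(5,7) forgotten_index_def first_zagreb_def
      of_nat_sum of_nat_power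
    by algebra
qed

end
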